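(* Work in CCSK$^{\mathrm{P}}$ as described in the context. For all proof keyed labels $\theta_1,\theta_2$: (i) if $\theta_1\,\iota\,\theta_2$ then $\theta_1\bowtie\theta_2$; (ii) if $\theta_1\otimes\theta_2$ then $\theta_1\bowtie\theta_2$; (iii) if $\theta_1\bowtie\theta_2$ then either $\theta_1\,\iota\,\theta_2$ or $\theta_1\otimes\theta_2$, but not both.
   Context: $\mathsf N$ is an infinite set of names with complement bijection $a\mapsto\overline a$; labels $\mathsf L=\mathsf N\cup\overline{\mathsf N}\cup\{\tau\}$ ranged over by $\alpha$, $\lambda$ ranges over $\mathsf L\setminus\{\tau\}$; $\mathsf K$ is a denumerable set of keys with decidable equality. Proof keyed labels: $\theta ::= v\,\alpha[k] \mid v\,\langle\theta_L,\theta_R\rangle$, where $v,v_1,v_2$ are finite strings over $\{|_L,|_R,+_L,+_R\}$ and $\theta_L=v_1\lambda[k]$, $\theta_R=v_2\overline\lambda[k]$ (same key). $s\theta$ denotes prefixing symbol $s$ to $\theta$, and $\alpha[k]$ denotes a label with empty string. $\mathrm{key}(v\alpha[k])=k$ and $\mathrm{key}(v\langle v_1\lambda[k],v_2\overline\lambda[k]\rangle)=k$. Let $D\in\{L,R\}$, $\overline L=R$, $\overline R=L$. Connectivity $\bowtie$ is the least relation closed under: (A$^1$) $\alpha[k]\bowtie\theta$; (A$^2$) $\theta\bowtie\alpha[k]$; (P$^1_D$) $\theta_1\bowtie\theta_2\Rightarrow|_D\theta_1\bowtie|_D\theta_2$; (P$^2_D$) $|_D\theta_1\bowtie|_{\overline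 D}\theta_2$; (C$^1_D$) $\theta_1\bowtie\theta_2\Rightarrow+_D\theta_1\bowtie+_D\theta_2$; (C$^2_D$) $+_D\theta_1\bowtie+_{\overline D}\theta_2$; (S$^1_D$) $\theta\bowtie\theta_D\Rightarrow|_D\theta\bowtie\langle\theta_L,\theta_R\rangle$; (S$^2_D$) $\theta_D\bowtie\theta\Rightarrow\langle\theta_L,\theta_R\rangle\bowtie|_D\theta$; (S$^3$) $\theta_1\bowtie\theta_1'$, $\theta_2\bowtie\theta_2'\Rightarrow\langle\theta_1,\theta_2\rangle\bowtie\langle\theta_1',\theta_2'\rangle$. Dependence $\otimes$ is the least relation closed under: (A$^1$) $\alpha[k]\otimes\theta$; (A$^2$) $\theta\otimes\alpha[k]$; (C$^1_D$) $\theta\otimes\theta'\Rightarrow+_D\theta\otimes+_D\theta'$; (C$^2_D$) $+_D\theta\otimes+_{\overline D}\theta'$; (P$^1_D$) $\theta\otimes\theta'\Rightarrow|_D\theta\otimes|_D\theta'$; (P$^2_D$) $\mathrm{key}(\theta)=\mathrm{key}(\theta')\Rightarrow|_D\theta\otimes|_{\overline D}\theta'$; (S$^1_D$) $\theta\otimes\theta_D\Rightarrow|_D\theta\otimes\langle\theta_L,\theta_R\rangle$; (S$^2_D$) $\theta_D\otimes\theta\Rightarrow\langle\theta_L,\theta_R\rangle\otimes|_D\theta$; (S$^3$) if $\{i,j\}=\{1,2\}$, $\theta_i\otimes\theta_i'$ and $\theta_j\bowtie\theta_j'$ then $\langle\theta_1,\theta_2\rangle\otimes\langle\theta_1',\theta_2'\rangle$.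 Independence $\iota$ is the least relation closed under (no action rules): (C$^1_D$) $\theta\,\iota\,\theta'\Rightarrow+_D\theta\,\iota\,+_D\theta'$; (P$^1_D$) $\theta\,\iota\,\theta'\Rightarrow|_D\theta\,\iota\,|_D\theta'$; (P$^2_D$) $\mathrm{key}(\theta)\neq\mathrm{key}(\theta')\Rightarrow|_D\theta\,\iota\,|_{\overline D}\theta'$; (S$^1_D$) $\theta\,\iota\,\theta_D\Rightarrow|_D\theta\,\iota\,\langle\theta_L,\theta_R\rangle$; (S$^2_D$) $\theta_D\,\iota\,\theta\Rightarrow\langle\theta_L,\theta_R\rangle\,\iota\,|_D\theta$; (S$^3$) $\theta_1\,\iota\,\theta_1'$, $\theta_2\,\iota\,\theta_2'\Rightarrow\langle\theta_1,\theta_2\rangle\,\iota\,\langle\theta_1',\theta_2'\rangle$. *)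

theory Defs
  imports "HOL-Library.Countable" "HOL-Library.Infinite_Typeclass"
begin

datatype 'n visible = Name 'n | Coname 'n

datatype 'n label = Vis "'n visible" | Tau

fun co :: "'n visible \<Rightarrow> 'n visible" where
  "co (Name a) = Coname a"
| "co (Coname a) = Name a"

datatype dir = DirL | DirR

fun opp :: "dir \<Rightarrow> dir" where
  "opp DirL = DirR"
| "opp DirR = DirL"

text \<open>\<open>Par D\<close> is the symbol \<open>|\<^sub>D\<close> and \<open>Sum D\<close> is the symbol \<open>+\<^sub>D\<close>.\<close>

datatype sym = Par dir | Sum dir

text \<open>
  \<open>Act v \<alpha> k\<close> is \<open>v \<alpha>[k]\<close>, and \<open>Sync v v1 v2 l k\<close> is \<open>v \<langle>v1 l[k], v2 (co l)[k]\<rangle>\<close>.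
  The grammar forces the two components of a synchronisation to carry complementary
  visible labels and the same key, so the label and the key are stored only once.
\<close>

datatype ('n, 'k) plabel =
    Act "sym list" "'n label" 'k
  | Sync "sym list" "sym list" "sym list" "'n visible" 'k

fun key :: "('n, 'k) plabel \<Rightarrow> 'k" where
  "key (Act v \<alpha> k) = k"
| "key (Sync v v1 v2 l k) = k"

fun pre :: "sym \<Rightarrow> ('n, 'k) plabel \<Rightarrow> ('n, 'k) plabel" where
  "pre s (Act v \<alpha> k) = Act (s # v) \<alpha> k"
| "pre s (Sync v v1 v2 l k) = Sync (s # v) v1 v2 l k"

text \<open>The component \<open>\<theta>\<^sub>D\<close> of \<open>\<langle>\<theta>\<^sub>L, \<theta>\<^sub>R\<rangle> = Sync [] v1 v2 l k\<close>.\<close>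

fun component :: "dir \<Rightarrow> sym list \<Rightarrow> sym list \<Rightarrow> 'n visible \<Rightarrow> 'k \<Rightarrow> ('n, 'k) plabel" where
  "component DirL v1 v2 l k = Act v1 (Vis l) k"
| "component DirR v1 v2 l k = Act v2 (Vis (co l)) k"

inductive connected :: "('n, 'k) plabel \<Rightarrow> ('n, 'k) plabel \<Rightarrow> bool" where
  conn_A1: "connected (Act [] \<alpha> k) \<theta>"
| conn_A2: "connected \<theta> (Act [] \<alpha> k)"
| conn_P1: "connected \<theta>1 \<theta>2 \<Longrightarrow> connected (pre (Par D) \<theta>1) (pre (Par D) \<theta>2)"
| conn_P2: "connected (pre (Par D) \<theta>1) (pre (Par (opp D)) \<theta>2)"
| conn_C1: "connected \<theta>1 \<theta>2 \<Longrightarrow> connected (pre (Sum D) \<theta>1) (pre (Sum D) \<theta>2)"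
| conn_C2: "connected (pre (Sum D) \<theta>1) (pre (Sum (opp D)) \<theta>2)"
| conn_S1: "connected \<theta> (component D v1 v2 l k) \<Longrightarrow>
    connected (pre (Par D) \<theta>) (Sync [] v1 v2 l k)"
| conn_S2: "connected (component D v1 v2 l k) \<theta> \<Longrightarrow>
    connected (Sync [] v1 v2 l k) (pre (Par D) \<theta>)"
| conn_S3: "connected (component DirL v1 v2 l k) (component DirL v1' v2' l' k') \<Longrightarrow>
    connected (component DirR v1 v2 l k) (component DirR v1' v2' l' k') \<Longrightarrow>
    connected (Sync [] v1 v2 l k) (Sync [] v1' v2' l' k')"

text \<open>The rule for two synchronisations with \<open>{i, j} = {1, 2}\<close> is split into \<open>dep_S3_1\<close>
  (\<open>i = 1\<close>) and \<open>dep_S3_2\<close> (\<open>i = 2\<close>).\<close>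

inductive dependent :: "('n, 'k) plabel \<Rightarrow> ('n, 'k) plabel \<Rightarrow> bool" where
  dep_A1: "dependent (Act [] \<alpha> k) \<theta>"
| dep_A2: "dependent \<theta> (Act [] \<alpha> k)"
| dep_C1: "dependent \<theta> \<theta>' \<Longrightarrow> dependent (pre (Sum D) \<theta>) (pre (Sum D) \<theta>')"
| dep_C2: "dependent (pre (Sum D) \<theta>) (pre (Sum (opp D)) \<theta>')"
| dep_P1: "dependent \<theta> \<theta>' \<Longrightarrow> dependent (pre (Par D) \<theta>) (pre (Par D) \<theta>')"
| dep_P2: "key \<theta> = key \<theta>' \<Longrightarrow> dependent (pre (Par D) \<theta>) (pre (Par (opp D)) \<theta>')"
| dep_S1: "dependent \<theta> (component D v1 v2 l k) \<Longrightarrow>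
    dependent (pre (Par D) \<theta>) (Sync [] v1 v2 l k)"
| dep_S2: "dependent (component D v1 v2 l k) \<theta> \<Longrightarrow>
    dependent (Sync [] v1 v2 l k) (pre (Par D) \<theta>)"
| dep_S3_1: "dependent (component DirL v1 v2 l k) (component DirL v1' v2' l' k') \<Longrightarrow>
    connected (component DirR v1 v2 l k) (component DirR v1' v2' l' k') \<Longrightarrow>
    dependent (Sync [] v1 v2 l k) (Sync [] v1' v2' l' k')"
| dep_S3_2: "dependent (component DirR v1 v2 l k) (component DirR v1' v2' l' k') \<Longrightarrow>
    connected (component DirL v1 v2 l k) (component DirL v1' v2' l' k') \<Longrightarrow>
    dependent (Sync [] v1 v2 l k) (Sync [] v1' v2' l' k')"

inductive independent :: "('n, 'k) plabel \<Rightarrow> ('n, 'k) plabel \<Rightarrow> bool" where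
  indep_C1: "independent \<theta> \<theta>' \<Longrightarrow> independent (pre (Sum D) \<theta>) (pre (Sum D) \<theta>')"
| indep_P1: "independent \<theta> \<theta>' \<Longrightarrow> independent (pre (Par D) \<theta>) (pre (Par D) \<theta>')"
| indep_P2: "key \<theta> \<noteq> key \<theta>' \<Longrightarrow> independent (pre (Par D) \<theta>) (pre (Par (opp D)) \<theta>')"
| indep_S1: "independent \<theta> (component D v1 v2 l k) \<Longrightarrow>
    independent (pre (Par D) \<theta>) (Sync [] v1 v2 l k)"
| indep_S2: "independent (component D v1 v2 l k) \<theta> \<Longrightarrow>
    independent (Sync [] v1 v2 l k) (pre (Par D) \<theta>)"
| indep_S3: "independent (component DirL v1 v2 l k) (component DirL v1' v2' l' k') \<Longrightarrow>
    independent (component DirR v1 v2 l k) (component DirR v1' v2' l' k') \<Longrightarrow>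
    independent (Sync [] v1 v2 l k) (Sync [] v1' v2' l' k')"

end

theory Submission
  imports Defs
begin

text \<open>The rules of connectivity split between the other two relations: empty-string actions
  and opposite sums give dependence, opposite sides of a parallel are settled by comparing keys, and
  all other rules pass the question to smaller labels. Rule induction thus yields both inclusions
  and the covering \<open>connected_imp_independent_or_dependent\<close>; rule inversion yields
  exclusivity, \<open>independent_imp_not_dependent\<close>.\<close>

lemma pre_eq_iff [simp]: "pre s \<theta> = pre s' \<theta>' \<longleftrightarrow> s = s' \<and> \<theta> = \<theta>'"
  by (cases \<theta>; cases \<theta>') auto

text \<open>\<open>pre\<close> is a function, not a constructor; injectivity and these disjointness
  facts let rule inversion treat it as one.\<close>

lemma pre_neq_Act_Nil [simp]: "pre s \<theta> \<noteq> Act [] \<alpha> k" "Act [] \<alpha> k \<noteq> pre s \<theta>"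
  by (cases \<theta>; simp)+

lemma pre_neq_Sync_Nil [simp]:
  "pre s \<theta> \<noteq> Sync [] v1 v2 l k" "Sync [] v1 v2 l k \<noteq> pre s \<theta>"
  by (cases \<theta>; simp)+

lemma opp_neq [simp]: "opp D \<noteq> D" "D \<noteq> opp D"
  by (cases D; simp)+

lemma independent_imp_connected: "independent \<theta>1 \<theta>2 \<Longrightarrow> connected \<theta>1 \<theta>2"
  by (induction rule: independent.induct) (rule connected.intros; assumption)+

lemma dependent_imp_connected: "dependent \<theta>1 \<theta>2 \<Longrightarrow> connected \<theta>1 \<theta>2"
  by (induction rule: dependent.induct) (rule connected.intros; assumption)+

lemma connected_imp_independent_or_dependent:
  "connected \<theta>1 \<theta>2 \<Longrightarrow> independent \<theta>1 \<theta>2 \<or> dependent \<theta>1 \<theta>2"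
proof (induction rule: connected.induct)
  case (conn_S3 v1 v2 l k v1' v2' l' k')
  then show ?case
    \<comment> \<open>If some component pair is dependent, the connectivity that
      \<open>dep_S3_1\<close> or \<open>dep_S3_2\<close> asks of the other pair is a premise of
      \<open>conn_S3\<close> itself.\<close>
    by (blast intro: indep_S3 dep_S3_1 dep_S3_2)
qed (blast intro: independent.intros dependent.intros)+

text \<open>Each dependence rule matching the shape of the pair contradicts the induction hypothesis
  or, for opposite parallel sides, the distinct keys. For two synchronisations, either rule needs
  one dependent component pair, yet both are independent.\<close>

lemma independent_imp_not_dependent: "independent \<theta>1 \<theta>2 \<Longrightarrow> \<not> dependent \<theta>1 \<theta>2"
  by (induction rule: independent.induct) (rule notI; erule dependent.cases; auto)+

theorem theorem2:
  fixes \<theta>1 \<theta>2 :: "('n :: infinite, 'k :: {countable, infinite}) plabel"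
  shows "(independent \<theta>1 \<theta>2 \<longrightarrow> connected \<theta>1 \<theta>2) \<and>
    (dependent \<theta>1 \<theta>2 \<longrightarrow> connected \<theta>1 \<theta>2) \<and>
    (connected \<theta>1 \<theta>2 \<longrightarrow>
      (independent \<theta>1 \<theta>2 \<or> dependent \<theta>1 \<theta>2) \<and> \<not> (independent \<theta>1 \<theta>2 \<and> dependent \<theta>1 \<theta>2))"
  using independent_imp_connected dependent_imp_connected
    connected_imp_independent_or_dependent independent_imp_not_dependent
  by blast

end
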